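(* Let $G$ be a group and let $X$ be a transitive $G$-space. Let $p\in\beta X$. Then $(\beta G)p=\{qp: q\in\beta G\}$ is a minimal invariant subset of $\beta X$ if and only if, for every $A\in p$, there exists a finite subset $F$ of $G$ such that $G=FA_p$, where $A_p=\{g\in G: A\in gp\}$ and $FA_p=\{fg: f\in F,\ g\in A_p\}$.
   Context: A $G$-space is a set $X$ with an action $G\times X\to X$, $(g,x)\mapsto gx$; it is transitive if for all $x,y\in X$ there is $g\in G$ with $gx=y$. $G$ and $X$ carry the discrete topology, and $\beta G$, $\beta X$ are identified with the sets of all ultrafilters on $G$ and on $X$ (principal ultrafilters identified with points), with the topology whose base consists of the sets $\overline{A}=\{p: A\in p\}$. For $g\in G$ and $p\in\beta X$, $gp=\{gP: P\in p\}$ where $gP=\{gx:x\in P\}$. For $q\in\beta G$ and $p\in\beta X$, $qp$ is the ultrafilter on $X$ given by: $A\in qp$ if and only if $\{g\in G: A\in gp\}\in q$; equivalently, it has as a base the sets $\bigcup_{g\in Q}gP_g$ with $Q\in q$ and $P_g\in p$ for each $g\in Q$ (so $q\mapsto qp$ is the continuous extension of $g\mapsto gp$). A closed subset $S\subseteq\beta X$ is invariant if $gp\in S$ whenever $g\in G$ and $p\in S$; a minimal invariant subset is a nonempty closed invariant subset minimal with respect to inclusion among such sets. *)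

theory Defs
  imports "HOL-Analysis.Abstract_Topology" "HOL-Algebra.Group_Action"
begin

definition ultrafilter_on :: "'a set \<Rightarrow> 'a set set \<Rightarrow> bool" where
  "ultrafilter_on X p \<longleftrightarrow>
     p \<subseteq> Pow X \<and> X \<in> p \<and> {} \<notin> p \<and>
     (\<forall>A\<in>p. \<forall>B\<in>p. A \<inter> B \<in> p) \<and>
     (\<forall>A\<in>p. \<forall>B. A \<subseteq> B \<and> B \<subseteq> X \<longrightarrow> B \<in> p) \<and>
     (\<forall>A. A \<subseteq> X \<longrightarrow> A \<in> p \<or> X - A \<in> p)"

definition ultrafilters :: "'a set \<Rightarrow> 'a set set set" where
  "ultrafilters X = {p. ultrafilter_on X p}"

definition ultra_basic :: "'a set \<Rightarrow> 'a set \<Rightarrow> 'a set set set" where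
  "ultra_basic X A = {p \<in> ultrafilters X. A \<in> p}"

definition stone_cech :: "'a set \<Rightarrow> 'a set set topology" where
  "stone_cech X = topology (arbitrary union_of (\<lambda>U. \<exists>A. A \<subseteq> X \<and> U = ultra_basic X A))"

lemma ultra_basic_Int:
  assumes "A \<subseteq> X" "B \<subseteq> X"
  shows "ultra_basic X A \<inter> ultra_basic X B = ultra_basic X (A \<inter> B)"
proof -
  have "A \<inter> B \<in> p \<longleftrightarrow> A \<in> p \<and> B \<in> p" if p: "ultrafilter_on X p" for p
  proof
    assume AB: "A \<inter> B \<in> p"
    have "\<forall>A\<in>p. \<forall>B. A \<subseteq> B \<and> B \<subseteq> X \<longrightarrow> B \<in> p"
      using p by (simp add: ultrafilter_on_def)
    then show "A \<in> p \<and> B \<in> p"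
      using AB assms by (meson inf_le1 inf_le2)
  next
    assume "A \<in> p \<and> B \<in> p"
    then show "A \<inter> B \<in> p"
      using p by (simp add: ultrafilter_on_def)
  qed
  then show ?thesis
    by (auto simp: ultra_basic_def ultrafilters_def)
qed

lemma openin_stone_cech:
  "openin (stone_cech X) = arbitrary union_of (\<lambda>U. \<exists>A. A \<subseteq> X \<and> U = ultra_basic X A)"
proof -
  have "istopology (arbitrary union_of (\<lambda>U. \<exists>A. A \<subseteq> X \<and> U = ultra_basic X A))"
  proof (rule istopology_base)
    fix S T
    assume "\<exists>A. A \<subseteq> X \<and> S = ultra_basic X A" "\<exists>A. A \<subseteq> X \<and> T = ultra_basic X A"
    then obtain A B where "A \<subseteq> X" "S = ultra_basic X A" "B \<subseteq> X" "T = ultra_basic X B"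
      by blast
    then show "\<exists>A. A \<subseteq> X \<and> S \<inter> T = ultra_basic X A"
      by (intro exI[of _ "A \<inter> B"]) (auto simp: ultra_basic_Int)
  qed
  then show ?thesis
    unfolding stone_cech_def by (rule topology_inverse')
qed

lemma topspace_stone_cech: "topspace (stone_cech X) = ultrafilters X"
proof
  show "topspace (stone_cech X) \<subseteq> ultrafilters X"
    unfolding topspace_def openin_stone_cech
    by (auto simp: union_of_def arbitrary_def ultra_basic_def)
  have "ultra_basic X X = ultrafilters X"
    by (auto simp: ultra_basic_def ultrafilters_def ultrafilter_on_def)
  then have "openin (stone_cech X) (ultrafilters X)"
    unfolding openin_stone_cech
    by (intro union_of_inc) (auto simp: arbitrary_def)
  then show "ultrafilters X \<subseteq> topspace (stone_cech X)"
    by (rule openin_subset)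
qed

definition ultra_act :: "('g \<Rightarrow> 'x \<Rightarrow> 'x) \<Rightarrow> 'g \<Rightarrow> 'x set set \<Rightarrow> 'x set set" where
  "ultra_act \<phi> g p = {\<phi> g ` P | P. P \<in> p}"

definition return_set ::
    "('g, 'm) monoid_scheme \<Rightarrow> ('g \<Rightarrow> 'x \<Rightarrow> 'x) \<Rightarrow> 'x set set \<Rightarrow> 'x set \<Rightarrow> 'g set" where
  "return_set G \<phi> p A = {g \<in> carrier G. A \<in> ultra_act \<phi> g p}"

definition ultra_prod ::
    "('g, 'm) monoid_scheme \<Rightarrow> 'x set \<Rightarrow> ('g \<Rightarrow> 'x \<Rightarrow> 'x) \<Rightarrow> 'g set set \<Rightarrow> 'x set set \<Rightarrow> 'x set set"
  where "ultra_prod G X \<phi> q p = {A. A \<subseteq> X \<and> {g \<in> carrier G. A \<in> ultra_act \<phi> g p} \<in> q}"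

definition closed_invariant ::
    "('g, 'm) monoid_scheme \<Rightarrow> 'x set \<Rightarrow> ('g \<Rightarrow> 'x \<Rightarrow> 'x) \<Rightarrow> 'x set set set \<Rightarrow> bool" where
  "closed_invariant G X \<phi> S \<longleftrightarrow>
     closedin (stone_cech X) S \<and> (\<forall>g\<in>carrier G. \<forall>p\<in>S. ultra_act \<phi> g p \<in> S)"

definition minimal_invariant ::
    "('g, 'm) monoid_scheme \<Rightarrow> 'x set \<Rightarrow> ('g \<Rightarrow> 'x \<Rightarrow> 'x) \<Rightarrow> 'x set set set \<Rightarrow> bool" where
  "minimal_invariant G X \<phi> S \<longleftrightarrow>
     S \<noteq> {} \<and> closed_invariant G X \<phi> S \<and>
     (\<forall>T. T \<noteq> {} \<and> closed_invariant G X \<phi> T \<and> T \<subseteq> S \<longrightarrow> T = S)"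

end

theory Submission
  imports Defs
begin

text \<open>
  The set \<open>(\<beta>G)p\<close> consists of the ultrafilters all of whose members belong to some translate
  \<open>gp\<close>; it is the closure of the orbit of \<open>p\<close>. The condition \<open>G = F A\<^sub>p\<close> says that the union
  of the translates \<open>fA\<close>, \<open>f \<in> F\<close>, belongs to every \<open>gp\<close>, hence to every ultrafilter \<open>r\<close> in
  the orbit closure; thus \<open>A\<close> belongs to a translate of \<open>r\<close>, and \<open>p\<close> lies in every nonempty closed
  invariant subset. Conversely, if no finite \<open>F\<close> works for \<open>A\<close>, then by compactness some \<open>qp\<close>
  contains the complements of all translates of \<open>A\<close>, and the orbit closure of \<open>qp\<close> misses \<open>p\<close>.
\<close>

section \<open>Ultrafilters\<close>

lemma
  assumes "p \<in> ultrafilters X"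
  shows ultrafilters_subset: "A \<in> p \<Longrightarrow> A \<subseteq> X"
    and ultrafilters_whole_mem: "X \<in> p"
    and ultrafilters_empty_not_mem: "{} \<notin> p"
    and ultrafilters_Int: "A \<in> p \<Longrightarrow> B \<in> p \<Longrightarrow> A \<inter> B \<in> p"
    and ultrafilters_mono: "A \<in> p \<Longrightarrow> A \<subseteq> B \<Longrightarrow> B \<subseteq> X \<Longrightarrow> B \<in> p"
    and ultrafilters_cases: "A \<subseteq> X \<Longrightarrow> A \<in> p \<or> X - A \<in> p"
  using assms unfolding ultrafilters_def ultrafilter_on_def by blast+

lemma ultrafilters_Diff_iff:
  assumes "p \<in> ultrafilters X" "A \<subseteq> X"
  shows "X - A \<in> p \<longleftrightarrow> A \<notin> p"
proof -
  have "\<not> (A \<in> p \<and> X - A \<in> p)"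
    using ultrafilters_Int[OF assms(1), of A "X - A"] ultrafilters_empty_not_mem[OF assms(1)]
    by (metis Diff_disjoint)
  then show ?thesis
    using ultrafilters_cases[OF assms] by blast
qed

lemma ultrafilters_Int_iff:
  assumes "p \<in> ultrafilters X" "A \<subseteq> X" "B \<subseteq> X"
  shows "A \<inter> B \<in> p \<longleftrightarrow> A \<in> p \<and> B \<in> p"
  using assms ultrafilters_Int ultrafilters_mono by (metis inf_le1 inf_le2)

text \<open>Complements turn a union into an intersection, and an ultrafilter decides every subset
  of \<open>X\<close>. This gives two sets at a time; induction gives finite unions.\<close>

lemma ultrafilters_UN_iff:
  assumes "p \<in> ultrafilters X" "finite F" "\<And>f. f \<in> F \<Longrightarrow> A f \<subseteq> X"
  shows "(\<Union>f\<in>F. A f) \<in> p \<longleftrightarrow> (\<exists>f\<in>F. A f \<in> p)"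
  using assms(2,3)
proof (induction F)
  case empty
  then show ?case using ultrafilters_empty_not_mem[OF assms(1)] by simp
next
  case (insert x F)
  have U: "A x \<subseteq> X" "(\<Union>f\<in>F. A f) \<subseteq> X"
    using insert.prems by auto
  have "A x \<union> (\<Union>f\<in>F. A f) \<notin> p \<longleftrightarrow> X - (A x \<union> (\<Union>f\<in>F. A f)) \<in> p"
    using U by (intro ultrafilters_Diff_iff[OF assms(1), symmetric]) blast
  also have "X - (A x \<union> (\<Union>f\<in>F. A f)) = (X - A x) \<inter> (X - (\<Union>f\<in>F. A f))"
    by blast
  also have "\<dots> \<in> p \<longleftrightarrow> A x \<notin> p \<and> (\<Union>f\<in>F. A f) \<notin> p"
    using U by (simp add: ultrafilters_Int_iff[OF assms(1)] ultrafilters_Diff_iff[OF assms(1)]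
        del: UN_simps)
  finally show ?case
    using insert by auto
qed

text \<open>Ultrafilters are maximal: the complement of a set missing from \<open>p\<close> lies in
  \<open>p\<close>, hence in \<open>q\<close>, so that set is missing from \<open>q\<close> as
  well.\<close>

lemma ultrafilters_subset_imp_eq:
  assumes "p \<in> ultrafilters X" "q \<in> ultrafilters X" "p \<subseteq> q"
  shows "p = q"
proof
  show "q \<subseteq> p"
  proof
    fix A assume A: "A \<in> q"
    then have AX: "A \<subseteq> X" using ultrafilters_subset[OF assms(2)] by simp
    have "X - A \<notin> p"
      using A ultrafilters_Diff_iff[OF assms(2) AX] assms(3) by blast
    then show "A \<in> p"
      using ultrafilters_Diff_iff[OF assms(1) AX] by simp
  qed
qed fact

text \<open>Zorn's lemma applied to the families with the finite intersection property; it serves as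
  the compactness of \<beta>G. The factor \<open>X\<close> matters for \<open>F = {}\<close>, where
  \<open>\<Inter>F\<close> is the whole type: there the hypothesis says that \<open>X\<close> is
  nonempty.\<close>

lemma ultrafilter_extension:
  assumes "C \<subseteq> Pow X"
    and fip: "\<And>F. finite F \<Longrightarrow> F \<subseteq> C \<Longrightarrow> X \<inter> \<Inter>F \<noteq> {}"
  obtains q where "q \<in> ultrafilters X" "C \<subseteq> q"
proof -
  define \<A> where "\<A> = {D. C \<subseteq> D \<and> D \<subseteq> Pow X \<and> (\<forall>F. finite F \<and> F \<subseteq> D \<longrightarrow> X \<inter> \<Inter>F \<noteq> {})}"
  have "\<exists>M\<in>\<A>. \<forall>D\<in>\<A>. M \<subseteq> D \<longrightarrow> D = M"
  proof (rule subset_Zorn_nonempty)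
    have "C \<in> \<A>"
      unfolding \<A>_def using assms by simp
    then show "\<A> \<noteq> {}"
      by blast
    fix \<C> assume ne: "\<C> \<noteq> {}" and ch: "subset.chain \<A> \<C>"
    have sub: "\<C> \<subseteq> \<A>"
      using ch by (simp add: subset_chain_def)
    have "X \<inter> \<Inter>F \<noteq> {}" if F: "finite F" "F \<subseteq> \<Union>\<C>" for F
    proof -
      \<comment> \<open>A finite part of the union of a chain already lies in one link, which has
        the intersection property.\<close>
      obtain D where "D \<in> \<C>" "F \<subseteq> D"
        using finite_subset_Union_chain[OF F ne ch] by blast
      then show ?thesis
        using sub F(1) unfolding \<A>_def by blast
    qed
    moreover have "C \<subseteq> \<Union>\<C>" "\<Union>\<C> \<subseteq> Pow X"
      using ne sub unfolding \<A>_def by blast+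
    ultimately show "\<Union>\<C> \<in> \<A>"
      unfolding \<A>_def by simp
  qed
  then obtain M where "M \<in> \<A>" and max: "\<And>D. D \<in> \<A> \<Longrightarrow> M \<subseteq> D \<Longrightarrow> D = M"
    by blast
  then have CM: "C \<subseteq> M" and MX: "M \<subseteq> Pow X"
    and M: "\<And>F. finite F \<Longrightarrow> F \<subseteq> M \<Longrightarrow> X \<inter> \<Inter>F \<noteq> {}"
    unfolding \<A>_def by auto
  \<comment> \<open>The use of maximality: a set meeting all finite intersections from
    \<open>M\<close> can be adjoined without losing the intersection property, so it is already in
    \<open>M\<close>. The closure properties of \<open>M\<close> all reduce to this.\<close>
  have mem: "A \<in> M" if "A \<subseteq> X" and A: "\<And>F. finite F \<Longrightarrow> F \<subseteq> M \<Longrightarrow> A \<inter> \<Inter>F \<noteq> {}" for A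
  proof -
    have "X \<inter> \<Inter>F \<noteq> {}" if F: "finite F" "F \<subseteq> insert A M" for F
    proof -
      have "A \<inter> \<Inter>(F - {A}) \<subseteq> X \<inter> \<Inter>F"
        using \<open>A \<subseteq> X\<close> by blast
      moreover have "A \<inter> \<Inter>(F - {A}) \<noteq> {}"
        using F by (intro A) auto
      ultimately show ?thesis by blast
    qed
    moreover have "C \<subseteq> insert A M" "insert A M \<subseteq> Pow X"
      using \<open>A \<subseteq> X\<close> CM MX by auto
    ultimately have "insert A M \<in> \<A>"
      unfolding \<A>_def by simp
    then show ?thesis
      using max by blast
  qed
  have "M \<in> ultrafilters X"
    unfolding ultrafilters_def ultrafilter_on_def mem_Collect_eq
  proof (intro conjI ballI allI impI)
    show "M \<subseteq> Pow X" by (rule MX)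
    show "X \<in> M" using mem M by blast
    show "{} \<notin> M" using M[of "{{}}"] by auto
    show "A \<inter> B \<in> M" if "A \<in> M" "B \<in> M" for A B
    proof (rule mem)
      show "A \<inter> B \<subseteq> X" using that MX by blast
      show "A \<inter> B \<inter> \<Inter>F \<noteq> {}" if "finite F" "F \<subseteq> M" for F
        using M[of "insert A (insert B F)"] that \<open>A \<in> M\<close> \<open>B \<in> M\<close> by auto
    qed
    show "B \<in> M" if "A \<in> M" "A \<subseteq> B \<and> B \<subseteq> X" for A B
    proof (rule mem)
      show "B \<subseteq> X" using that by blast
      show "B \<inter> \<Inter>F \<noteq> {}" if "finite F" "F \<subseteq> M" for F
        using M[of "insert A F"] that \<open>A \<in> M\<close> \<open>A \<subseteq> B \<and> B \<subseteq> X\<close> by auto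
    qed
    show "A \<in> M \<or> X - A \<in> M" if AX: "A \<subseteq> X" for A
    proof (rule ccontr)
      assume "\<not> (A \<in> M \<or> X - A \<in> M)"
      then have "A \<notin> M" "X - A \<notin> M"
        by auto
      \<comment> \<open>\<open>F\<close> blocks the adjunction of \<open>A\<close> and
        \<open>F'\<close> that of its complement; together they would have empty intersection inside
        \<open>X\<close>.\<close>
      then obtain F F' where F: "finite F" "F \<subseteq> M" "A \<inter> \<Inter>F = {}"
        and F': "finite F'" "F' \<subseteq> M" "(X - A) \<inter> \<Inter>F' = {}"
        using mem[OF AX] mem[OF Diff_subset] by metis
      then have "X \<inter> \<Inter>(F \<union> F') = {}"
        by blast
      then show False
        using M[of "F \<union> F'"] F F' by blast
    qed
  qed
  then show thesis
    using that CM by blast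
qed

text \<open>The complement of \<open>S\<close> must contain a basic neighbourhood of each of its
  points. This is the form in which closedness is used from here on.\<close>

lemma closedin_stone_cech_iff:
  "closedin (stone_cech X) S \<longleftrightarrow>
    S \<subseteq> ultrafilters X \<and> (\<forall>r\<in>ultrafilters X - S. \<exists>A\<in>r. \<forall>s\<in>S. A \<notin> s)"
proof (cases "S \<subseteq> ultrafilters X")
  case True
  have "closedin (stone_cech X) S \<longleftrightarrow>
      (\<forall>r\<in>ultrafilters X - S. \<exists>A\<subseteq>X. r \<in> ultra_basic X A \<and> ultra_basic X A \<subseteq> ultrafilters X - S)"
    unfolding closedin_def topspace_stone_cech openin_stone_cech arbitrary_union_of_alt
    using True by (simp only: simp_thms ex_simps[symmetric]) metis
  also have "\<dots> \<longleftrightarrow> (\<forall>r\<in>ultrafilters X - S. \<exists>A\<in>r. \<forall>s\<in>S. A \<notin> s)"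
  proof (rule ball_cong[OF refl])
    fix r assume r: "r \<in> ultrafilters X - S"
    have "A \<subseteq> X \<and> r \<in> ultra_basic X A \<and> ultra_basic X A \<subseteq> ultrafilters X - S \<longleftrightarrow>
        A \<in> r \<and> (\<forall>s\<in>S. A \<notin> s)" for A
    proof -
      have "A \<in> r \<Longrightarrow> A \<subseteq> X"
        using r ultrafilters_subset[of r X A] by simp
      moreover have "r \<in> ultra_basic X A \<longleftrightarrow> A \<in> r"
        using r by (simp add: ultra_basic_def)
      moreover have "ultra_basic X A \<subseteq> ultrafilters X - S \<longleftrightarrow> (\<forall>s\<in>S. A \<notin> s)"
        using True by (auto simp: ultra_basic_def)
      ultimately show ?thesis by blast
    qed
    then show "(\<exists>A\<subseteq>X. r \<in> ultra_basic X A \<and> ultra_basic X A \<subseteq> ultrafilters X - S) \<longleftrightarrow>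
        (\<exists>A\<in>r. \<forall>s\<in>S. A \<notin> s)"
      unfolding Bex_def by simp
  qed
  finally show ?thesis
    using True by blast
next
  case False
  then show ?thesis
    by (auto simp: closedin_def topspace_stone_cech)
qed

section \<open>The action on ultrafilters\<close>

lemma ultra_act_eq_image: "ultra_act \<phi> g p = (\<lambda>P. \<phi> g ` P) ` p"
  unfolding ultra_act_def by blast

context group_action
begin

lemma group_G: "group G"
  using group_hom group_hom.axioms(1) by auto

lemma image_subset_E: "g \<in> carrier G \<Longrightarrow> A \<subseteq> E \<Longrightarrow> \<phi> g ` A \<subseteq> E"
  using surj_prop by blast

lemma image_mult:
  assumes "g \<in> carrier G" "h \<in> carrier G" "A \<subseteq> E"
  shows "\<phi> (g \<otimes> h) ` A = \<phi> g ` \<phi> h ` A"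
proof -
  have "\<phi> (g \<otimes> h) x = \<phi> g (\<phi> h x)" if "x \<in> A" for x
    using that assms by (intro composition_rule) auto
  then show ?thesis
    unfolding image_image by (intro image_cong) auto
qed

lemma image_one:
  assumes "A \<subseteq> E"
  shows "\<phi> \<one> ` A = A"
proof -
  have "\<phi> \<one> x = x" if "x \<in> A" for x
    using that assms by (subst id_eq_one[symmetric]) auto
  then show ?thesis by force
qed

lemma image_inv_image:
  assumes "g \<in> carrier G" "A \<subseteq> E"
  shows "\<phi> (inv g) ` \<phi> g ` A = A" "\<phi> g ` \<phi> (inv g) ` A = A"
proof -
  interpret group G by (rule group_G)
  show "\<phi> (inv g) ` \<phi> g ` A = A" "\<phi> g ` \<phi> (inv g) ` A = A"
    using assms image_mult[of "inv g" g A] image_mult[of g "inv g" A] image_one by auto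
qed

lemma mem_ultra_act_iff:
  assumes "p \<in> ultrafilters E" "g \<in> carrier G" "A \<subseteq> E"
  shows "A \<in> ultra_act \<phi> g p \<longleftrightarrow> \<phi> (inv g) ` A \<in> p"
proof
  assume "A \<in> ultra_act \<phi> g p"
  then obtain P where "P \<in> p" "A = \<phi> g ` P"
    unfolding ultra_act_def by blast
  then show "\<phi> (inv g) ` A \<in> p"
    using image_inv_image(1)[OF assms(2)] ultrafilters_subset[OF assms(1)] by simp
next
  assume "\<phi> (inv g) ` A \<in> p"
  then show "A \<in> ultra_act \<phi> g p"
    using image_inv_image(2)[OF assms(2,3)] unfolding ultra_act_def by blast
qed

text \<open>Membership in the translate is tested by applying \<open>\<phi> (inv g)\<close>. Being a
  permutation of \<open>E\<close>, it commutes with intersections and complements, so each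
  ultrafilter axiom is inherited from \<open>p\<close>.\<close>

lemma ultra_act_in_ultrafilters:
  assumes p: "p \<in> ultrafilters E" and g: "g \<in> carrier G"
  shows "ultra_act \<phi> g p \<in> ultrafilters E"
proof -
  interpret group G by (rule group_G)
  let ?h = "\<phi> (inv g)"
  have h: "?h ` E = E" and inj: "inj_on ?h E"
    using g by (simp_all add: surj_prop inj_prop)
  have sub: "A \<subseteq> E" if "A \<in> ultra_act \<phi> g p" for A
    using that image_subset_E[OF g] ultrafilters_subset[OF p] unfolding ultra_act_def by blast
  note iff = mem_ultra_act_iff[OF p g]
  show ?thesis
    unfolding ultrafilters_def ultrafilter_on_def mem_Collect_eq
  proof (intro conjI ballI allI impI)
    show "ultra_act \<phi> g p \<subseteq> Pow E" using sub by blast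
    show "E \<in> ultra_act \<phi> g p" using ultrafilters_whole_mem[OF p] h by (simp add: iff)
    show "{} \<notin> ultra_act \<phi> g p" using ultrafilters_empty_not_mem[OF p] by (simp add: iff)
    show "A \<inter> B \<in> ultra_act \<phi> g p" if "A \<in> ultra_act \<phi> g p" "B \<in> ultra_act \<phi> g p" for A B
    proof -
      have AB: "A \<subseteq> E" "B \<subseteq> E" "A \<inter> B \<subseteq> E" using that sub by blast+
      have "?h ` (A \<inter> B) = ?h ` A \<inter> ?h ` B"
        using inj_on_image_Int[OF inj AB(1,2)] .
      then show ?thesis
        using that AB iff ultrafilters_Int[OF p] by simp
    qed
    show "B \<in> ultra_act \<phi> g p" if "A \<in> ultra_act \<phi> g p" "A \<subseteq> B \<and> B \<subseteq> E" for A B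
      using that iff[OF sub[OF that(1)]] iff[of B] ultrafilters_mono[OF p, of "?h ` A" "?h ` B"]
        image_subset_E[of "inv g" B] g by auto
    show "A \<in> ultra_act \<phi> g p \<or> E - A \<in> ultra_act \<phi> g p" if "A \<subseteq> E" for A
    proof -
      have "?h ` (E - A) = E - ?h ` A"
        using inj_on_image_set_diff[OF inj _ that, of E] h by simp
      then show ?thesis
        using that iff[of A] iff[of "E - A"] ultrafilters_cases[OF p, of "?h ` A"]
          image_subset_E[of "inv g" A] g by auto
    qed
  qed
qed

lemma ultra_act_mult:
  assumes "p \<in> ultrafilters E" "g \<in> carrier G" "h \<in> carrier G"
  shows "ultra_act \<phi> g (ultra_act \<phi> h p) = ultra_act \<phi> (g \<otimes> h) p"
proof -
  have "\<phi> (g \<otimes> h) ` P = \<phi> g ` \<phi> h ` P" if "P \<in> p" for P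
    using image_mult[OF assms(2,3) ultrafilters_subset[OF assms(1) that]] .
  then have "(\<lambda>P. \<phi> (g \<otimes> h) ` P) ` p = (\<lambda>P. \<phi> g ` \<phi> h ` P) ` p"
    by (rule image_cong[OF refl])
  then show ?thesis
    by (simp add: ultra_act_eq_image image_image)
qed

lemma ultra_act_one:
  assumes "p \<in> ultrafilters E"
  shows "ultra_act \<phi> \<one> p = p"
proof -
  have "(\<lambda>P. \<phi> \<one> ` P) ` p = (\<lambda>P. P) ` p"
    by (rule image_cong[OF refl image_one[OF ultrafilters_subset[OF assms]]])
  then show ?thesis
    by (simp add: ultra_act_eq_image)
qed

section \<open>Return sets and the product of ultrafilters\<close>

lemma return_set_Int:
  assumes "p \<in> ultrafilters E" "A \<subseteq> E" "B \<subseteq> E"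
  shows "return_set G \<phi> p (A \<inter> B) = return_set G \<phi> p A \<inter> return_set G \<phi> p B"
  using assms ultrafilters_Int_iff[OF ultra_act_in_ultrafilters] unfolding return_set_def by auto

lemma return_set_Diff:
  assumes "p \<in> ultrafilters E" "A \<subseteq> E"
  shows "return_set G \<phi> p (E - A) = carrier G - return_set G \<phi> p A"
  using assms ultrafilters_Diff_iff[OF ultra_act_in_ultrafilters] unfolding return_set_def by auto

lemma mem_ultra_prod_iff:
  "A \<in> ultra_prod G E \<phi> q p \<longleftrightarrow> A \<subseteq> E \<and> return_set G \<phi> p A \<in> q"
  unfolding ultra_prod_def return_set_def by simp

text \<open>Taking return sets commutes with intersections and complements, because every translate
  of \<open>p\<close> is an ultrafilter. The product is the pullback of \<open>q\<close> along this
  map, so the axioms pass from \<open>q\<close> to it.\<close>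

lemma ultra_prod_in_ultrafilters:
  assumes p: "p \<in> ultrafilters E" and q: "q \<in> ultrafilters (carrier G)"
  shows "ultra_prod G E \<phi> q p \<in> ultrafilters E"
proof -
  have sub: "return_set G \<phi> p A \<subseteq> carrier G" for A
    unfolding return_set_def by blast
  have E: "return_set G \<phi> p E = carrier G"
    using ultrafilters_whole_mem[OF ultra_act_in_ultrafilters[OF p]] unfolding return_set_def by auto
  show ?thesis
    unfolding ultrafilters_def ultrafilter_on_def mem_Collect_eq mem_ultra_prod_iff
  proof (intro conjI ballI allI impI; (elim conjE)?)
    show "ultra_prod G E \<phi> q p \<subseteq> Pow E"
      by (auto simp: mem_ultra_prod_iff)
    show "E \<subseteq> E" ..
    show "return_set G \<phi> p E \<in> q"
      using E ultrafilters_whole_mem[OF q] by simp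
    \<comment> \<open>The empty set is the complement of \<open>E\<close>, so its return set is the
      complement of the whole group.\<close>
    show "\<not> ({} \<subseteq> E \<and> return_set G \<phi> p {} \<in> q)"
      using return_set_Diff[OF p, of E] E ultrafilters_empty_not_mem[OF q] by simp
  next
    fix A B assume "A \<in> ultra_prod G E \<phi> q p" "B \<in> ultra_prod G E \<phi> q p"
    then show "A \<inter> B \<subseteq> E" "return_set G \<phi> p (A \<inter> B) \<in> q"
      using return_set_Int[OF p] ultrafilters_Int[OF q] by (auto simp: mem_ultra_prod_iff)
  next
    fix A B assume A: "A \<in> ultra_prod G E \<phi> q p" and B: "A \<subseteq> B" "B \<subseteq> E"
    show "B \<subseteq> E" by fact
    have "return_set G \<phi> p A \<subseteq> return_set G \<phi> p B"
      unfolding return_set_def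
      using ultrafilters_mono[OF ultra_act_in_ultrafilters[OF p] _ B] by auto
    then show "return_set G \<phi> p B \<in> q"
      using A sub ultrafilters_mono[OF q] by (auto simp: mem_ultra_prod_iff)
  next
    fix A assume "A \<subseteq> E"
    then show "A \<subseteq> E \<and> return_set G \<phi> p A \<in> q \<or> E - A \<subseteq> E \<and> return_set G \<phi> p (E - A) \<in> q"
      using return_set_Diff[OF p] ultrafilters_cases[OF q sub] by auto
  qed
qed

section \<open>Orbit closures and minimality\<close>

definition orbit_closure where
  "orbit_closure p = {ultra_prod G E \<phi> q p | q. q \<in> ultrafilters (carrier G)}"

text \<open>The right side is membership in the topological closure of the orbit. From left to
  right, return sets belonging to \<open>q\<close> are nonempty. Conversely, the return sets of
  members of \<open>r\<close> have the finite intersection property, and any \<open>q\<close>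
  containing them all gives back \<open>r\<close>.\<close>

lemma mem_orbit_closure_iff:
  assumes p: "p \<in> ultrafilters E"
  shows "r \<in> orbit_closure p \<longleftrightarrow>
    r \<in> ultrafilters E \<and> (\<forall>A\<in>r. \<exists>g\<in>carrier G. A \<in> ultra_act \<phi> g p)"
    (is "?L \<longleftrightarrow> ?R")
proof
  assume ?L
  then obtain q where q: "q \<in> ultrafilters (carrier G)" "r = ultra_prod G E \<phi> q p"
    unfolding orbit_closure_def by blast
  have "\<exists>g\<in>carrier G. A \<in> ultra_act \<phi> g p" if "A \<in> r" for A
  proof -
    have "return_set G \<phi> p A \<noteq> {}"
      using that q ultrafilters_empty_not_mem[OF q(1)] by (auto simp: mem_ultra_prod_iff)
    then show ?thesis
      unfolding return_set_def by blast
  qed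
  then show ?R
    using q ultra_prod_in_ultrafilters[OF p] by blast
next
  assume ?R
  then have r: "r \<in> ultrafilters E"
    and *: "\<And>A. A \<in> r \<Longrightarrow> \<exists>g\<in>carrier G. A \<in> ultra_act \<phi> g p"
    by auto
  \<comment> \<open>Strengthened for the induction: a finite intersection of return sets contains
    the return set of one member of \<open>r\<close>, obtained by intersecting the members involved.
    Nonemptiness of single return sets then suffices.\<close>
  have "\<exists>B\<in>r. return_set G \<phi> p B \<subseteq> carrier G \<inter> \<Inter>F"
    if "finite F" "F \<subseteq> return_set G \<phi> p ` r" for F
    using that
  proof (induction F)
    case empty
    then show ?case using ultrafilters_whole_mem[OF r] unfolding return_set_def by auto
  next
    case (insert S F)
    then obtain A B where AB: "A \<in> r" "S = return_set G \<phi> p A"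
      "B \<in> r" "return_set G \<phi> p B \<subseteq> carrier G \<inter> \<Inter>F"
      by auto
    then have "A \<inter> B \<in> r" "return_set G \<phi> p (A \<inter> B) = S \<inter> return_set G \<phi> p B"
      using ultrafilters_Int[OF r] return_set_Int[OF p] ultrafilters_subset[OF r] by auto
    then show ?case
      using AB by (intro bexI[of _ "A \<inter> B"]) auto
  qed
  moreover have "return_set G \<phi> p B \<noteq> {}" if "B \<in> r" for B
    using *[OF that] unfolding return_set_def by blast
  ultimately have "carrier G \<inter> \<Inter>F \<noteq> {}" if "finite F" "F \<subseteq> return_set G \<phi> p ` r" for F
    using that by (metis subset_empty)
  moreover have "return_set G \<phi> p ` r \<subseteq> Pow (carrier G)"
    unfolding return_set_def by blast
  ultimately obtain q where q: "q \<in> ultrafilters (carrier G)" "return_set G \<phi> p ` r \<subseteq> q"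
    using ultrafilter_extension by metis
  \<comment> \<open>One inclusion is enough, since both sides are ultrafilters.\<close>
  have "r \<subseteq> ultra_prod G E \<phi> q p"
    using q(2) ultrafilters_subset[OF r] by (auto simp: mem_ultra_prod_iff)
  then have "r = ultra_prod G E \<phi> q p"
    using ultrafilters_subset_imp_eq[OF r ultra_prod_in_ultrafilters[OF p q(1)]] by blast
  then show ?L
    using q(1) unfolding orbit_closure_def by blast
qed

lemma self_mem_orbit_closure:
  assumes "p \<in> ultrafilters E"
  shows "p \<in> orbit_closure p"
proof -
  interpret group G by (rule group_G)
  show ?thesis
    unfolding mem_orbit_closure_iff[OF assms]
    using assms ultra_act_one[OF assms] one_closed by metis
qed

text \<open>A set in no translate of \<open>p\<close> lies in no element of the orbit closure, so it
  separates \<open>r\<close> from all of them. For invariance, \<open>P \<in> gp\<close> gives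
  \<open>hP \<in> (hg)p\<close>.\<close>

lemma closed_invariant_orbit_closure:
  assumes p: "p \<in> ultrafilters E"
  shows "closed_invariant G E \<phi> (orbit_closure p)"
proof -
  interpret group G by (rule group_G)
  note iff = mem_orbit_closure_iff[OF p]
  have "closedin (stone_cech E) (orbit_closure p)"
    unfolding closedin_stone_cech_iff
  proof (intro conjI ballI)
    show "orbit_closure p \<subseteq> ultrafilters E" using iff by blast
    fix r assume "r \<in> ultrafilters E - orbit_closure p"
    then obtain A where "A \<in> r" "\<And>g. g \<in> carrier G \<Longrightarrow> A \<notin> ultra_act \<phi> g p"
      using iff by blast
    then show "\<exists>A\<in>r. \<forall>s\<in>orbit_closure p. A \<notin> s"
      using iff by blast
  qed
  moreover have "ultra_act \<phi> h r \<in> orbit_closure p"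
    if h: "h \<in> carrier G" and "r \<in> orbit_closure p" for h r
  proof -
    have r: "r \<in> ultrafilters E" "\<And>A. A \<in> r \<Longrightarrow> \<exists>g\<in>carrier G. A \<in> ultra_act \<phi> g p"
      using \<open>r \<in> orbit_closure p\<close> unfolding iff by auto
    have "\<exists>g\<in>carrier G. \<phi> h ` P \<in> ultra_act \<phi> g p" if P: "P \<in> r" for P
    proof -
      obtain g where g: "g \<in> carrier G" "P \<in> ultra_act \<phi> g p"
        using r(2)[OF P] by blast
      then have "\<phi> h ` P \<in> ultra_act \<phi> h (ultra_act \<phi> g p)"
        unfolding ultra_act_def[of \<phi> h] by blast
      then show ?thesis
        using ultra_act_mult[OF p h g(1)] h g(1) by auto
    qed
    then show ?thesis
      unfolding iff using ultra_act_in_ultrafilters[OF r(1) h] by (auto simp: ultra_act_def)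
  qed
  ultimately show ?thesis
    unfolding closed_invariant_def by blast
qed

text \<open>Invariance puts the whole orbit into \<open>T\<close>. A point outside \<open>T\<close>
  would have a member belonging to no element of \<open>T\<close>, yet each member of a point of the
  orbit closure lies in some translate of \<open>p\<close>.\<close>

lemma orbit_closure_subset:
  assumes T: "closed_invariant G E \<phi> T" and "p \<in> T"
  shows "orbit_closure p \<subseteq> T"
proof
  have TE: "T \<subseteq> ultrafilters E"
    and closed: "\<And>r. r \<in> ultrafilters E - T \<Longrightarrow> \<exists>A\<in>r. \<forall>s\<in>T. A \<notin> s"
    using T unfolding closed_invariant_def closedin_stone_cech_iff by auto
  have p: "p \<in> ultrafilters E"
    using TE \<open>p \<in> T\<close> by blast
  fix r assume "r \<in> orbit_closure p"
  then have r: "r \<in> ultrafilters E" "\<And>A. A \<in> r \<Longrightarrow> \<exists>g\<in>carrier G. A \<in> ultra_act \<phi> g p"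
    unfolding mem_orbit_closure_iff[OF p] by auto
  have "ultra_act \<phi> g p \<in> T" if "g \<in> carrier G" for g
    using T that \<open>p \<in> T\<close> unfolding closed_invariant_def by blast
  then show "r \<in> T"
    using closed r by blast
qed

text \<open>Minimality amounts to \<open>p\<close> lying in the orbit closure of each
  \<open>r\<close> in its own orbit closure; the right side unfolds this by
  \<open>mem_orbit_closure_iff\<close>.\<close>

lemma minimal_invariant_orbit_closure_iff:
  assumes p: "p \<in> ultrafilters E"
  shows "minimal_invariant G E \<phi> (orbit_closure p) \<longleftrightarrow>
    (\<forall>A\<in>p. \<forall>r\<in>orbit_closure p. \<exists>g\<in>carrier G. A \<in> ultra_act \<phi> g r)"
    (is "?L \<longleftrightarrow> ?R")
proof
  assume min: ?L
  show ?R
  proof (intro ballI)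
    fix A r assume A: "A \<in> p" and "r \<in> orbit_closure p"
    then have r: "r \<in> ultrafilters E"
      using mem_orbit_closure_iff[OF p] by blast
    have "orbit_closure r \<subseteq> orbit_closure p"
      using min \<open>r \<in> orbit_closure p\<close>
      by (intro orbit_closure_subset) (auto simp: minimal_invariant_def)
    moreover have "orbit_closure r \<noteq> {}"
      using self_mem_orbit_closure[OF r] by blast
    ultimately have "orbit_closure r = orbit_closure p"
      using min closed_invariant_orbit_closure[OF r] unfolding minimal_invariant_def by blast
    then have "p \<in> orbit_closure r"
      using self_mem_orbit_closure[OF p] by blast
    then show "\<exists>g\<in>carrier G. A \<in> ultra_act \<phi> g r"
      using A unfolding mem_orbit_closure_iff[OF r] by blast
  qed
next
  assume R: ?R
  have "T = orbit_closure p"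
    if "T \<noteq> {}" and T: "closed_invariant G E \<phi> T" and sub: "T \<subseteq> orbit_closure p" for T
  proof -
    obtain r where "r \<in> T"
      using \<open>T \<noteq> {}\<close> by blast
    \<comment> \<open>The translate of \<open>r\<close> containing \<open>A\<close> stays in
      \<open>T\<close>. Thus every basic neighbourhood of \<open>p\<close> meets \<open>T\<close>,
      and closedness gives \<open>p \<in> T\<close>.\<close>
    have "\<exists>s\<in>T. A \<in> s" if A: "A \<in> p" for A
    proof -
      obtain g where "g \<in> carrier G" "A \<in> ultra_act \<phi> g r"
        using R A sub \<open>r \<in> T\<close> by blast
      then show ?thesis
        using T \<open>r \<in> T\<close> unfolding closed_invariant_def by blast
    qed
    moreover have "\<exists>A\<in>p. \<forall>s\<in>T. A \<notin> s" if "p \<notin> T"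
      using T p that unfolding closed_invariant_def closedin_stone_cech_iff by simp
    ultimately have "p \<in> T"
      by metis
    then show ?thesis
      using orbit_closure_subset[OF T] sub by blast
  qed
  moreover have "orbit_closure p \<noteq> {}"
    using self_mem_orbit_closure[OF p] by blast
  ultimately show ?L
    using closed_invariant_orbit_closure[OF p] unfolding minimal_invariant_def by metis
qed

section \<open>Finite covers of the group by translates of return sets\<close>

lemma image_mem_ultra_act_iff:
  assumes p: "p \<in> ultrafilters E" and "A \<subseteq> E" "f \<in> carrier G" "g \<in> carrier G"
  shows "\<phi> f ` A \<in> ultra_act \<phi> g p \<longleftrightarrow> inv f \<otimes> g \<in> return_set G \<phi> p A"
proof -
  interpret group G by (rule group_G)
  have "inv f \<otimes> g \<in> return_set G \<phi> p A \<longleftrightarrow> A \<in> ultra_act \<phi> (inv f) (ultra_act \<phi> g p)"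
    using assms by (simp add: return_set_def ultra_act_mult)
  also have "\<dots> \<longleftrightarrow> \<phi> f ` A \<in> ultra_act \<phi> g p"
    using assms ultra_act_in_ultrafilters[OF p, of g] by (simp add: mem_ultra_act_iff)
  finally show ?thesis by simp
qed

text \<open>Solving \<open>g = f \<otimes> h\<close> for \<open>h\<close> moves \<open>f\<close>
  from the group onto the set \<open>A\<close>, turning a cover of the group into a property of the
  translates of \<open>p\<close>.\<close>

lemma carrier_eq_set_mult_return_set_iff:
  assumes p: "p \<in> ultrafilters E" and A: "A \<subseteq> E" and F: "F \<subseteq> carrier G"
  shows "carrier G = F <#> return_set G \<phi> p A \<longleftrightarrow>
    (\<forall>g\<in>carrier G. \<exists>f\<in>F. \<phi> f ` A \<in> ultra_act \<phi> g p)"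
proof -
  interpret group G by (rule group_G)
  have sub: "return_set G \<phi> p A \<subseteq> carrier G"
    unfolding return_set_def by blast
  have "g \<in> F <#> return_set G \<phi> p A \<longleftrightarrow> (\<exists>f\<in>F. \<phi> f ` A \<in> ultra_act \<phi> g p)"
    if g: "g \<in> carrier G" for g
  proof -
    have "(\<exists>h\<in>return_set G \<phi> p A. g = f \<otimes> h) \<longleftrightarrow> \<phi> f ` A \<in> ultra_act \<phi> g p" if "f \<in> F" for f
    proof -
      have f: "f \<in> carrier G" using that F by blast
      have "g = f \<otimes> h \<longleftrightarrow> h = inv f \<otimes> g" if "h \<in> return_set G \<phi> p A" for h
        using that sub f g inv_solve_left[of h f g] by blast
      then show ?thesis
        unfolding image_mem_ultra_act_iff[OF p A f g] by (simp cong: bex_cong)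
    qed
    then show ?thesis
      unfolding set_mult_def by auto
  qed
  moreover have "F <#> return_set G \<phi> p A \<subseteq> carrier G"
    using F sub by (rule set_mult_closed)
  ultimately show ?thesis by blast
qed

lemma orbit_closure_recurrent_iff_syndetic:
  assumes p: "p \<in> ultrafilters E" and A: "A \<subseteq> E"
  shows "(\<forall>r\<in>orbit_closure p. \<exists>g\<in>carrier G. A \<in> ultra_act \<phi> g r) \<longleftrightarrow>
    (\<exists>F. finite F \<and> F \<subseteq> carrier G \<and> carrier G = F <#> return_set G \<phi> p A)"
    (is "_ \<longleftrightarrow> ?R")
proof
  interpret group G by (rule group_G)
  assume rec: "\<forall>r\<in>orbit_closure p. \<exists>g\<in>carrier G. A \<in> ultra_act \<phi> g r"
  show ?R
  proof (rule ccontr)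
    assume "\<not> ?R"
    then have no: "\<exists>g\<in>carrier G. \<forall>f\<in>F. \<phi> f ` A \<notin> ultra_act \<phi> g p"
      if "finite F" "F \<subseteq> carrier G" for F
      using that carrier_eq_set_mult_return_set_iff[OF p A that(2)] by metis
    \<comment> \<open>\<open>R f\<close> collects the \<open>g\<close> whose translate of
      \<open>p\<close> avoids \<open>fA\<close>; failure of every finite \<open>F\<close> is the
      finite intersection property of these sets. As return sets of complements, once in
      \<open>q\<close> they put those complements into the product.\<close>
    define R where "R f = return_set G \<phi> p (E - \<phi> f ` A)" for f
    have R_eq: "R f = {g \<in> carrier G. \<phi> f ` A \<notin> ultra_act \<phi> g p}" if "f \<in> carrier G" for f
      unfolding R_def return_set_Diff[OF p image_subset_E[OF that A]]
      by (auto simp: return_set_def)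
    have "carrier G \<inter> \<Inter>S \<noteq> {}" if S: "finite S" "S \<subseteq> R ` carrier G" for S
    proof -
      obtain F where "F \<subseteq> carrier G" "finite F" "S = R ` F"
        using finite_subset_image[OF S] by blast
      moreover obtain g where "g \<in> carrier G" "\<forall>f\<in>F. \<phi> f ` A \<notin> ultra_act \<phi> g p"
        using no calculation by blast
      ultimately have "g \<in> carrier G \<inter> \<Inter>S"
        using R_eq by auto
      then show ?thesis by blast
    qed
    moreover have "R ` carrier G \<subseteq> Pow (carrier G)"
      unfolding R_def return_set_def by blast
    ultimately obtain q where q: "q \<in> ultrafilters (carrier G)" "R ` carrier G \<subseteq> q"
      using ultrafilter_extension by metis
    let ?r = "ultra_prod G E \<phi> q p"
    have r: "?r \<in> ultrafilters E"
      by (rule ultra_prod_in_ultrafilters[OF p q(1)])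
    \<comment> \<open>Recurrence at \<open>?r\<close> puts the translate of \<open>A\<close> by
      \<open>inv g\<close> into \<open>?r\<close>, whereas \<open>R (inv g) \<in> q\<close> puts its
      complement there.\<close>
    obtain g where g: "g \<in> carrier G" "A \<in> ultra_act \<phi> g ?r"
      using rec q(1) unfolding orbit_closure_def by blast
    then have "\<phi> (inv g) ` A \<in> ?r"
      using mem_ultra_act_iff[OF r g(1) A] by simp
    moreover have "E - \<phi> (inv g) ` A \<in> ?r"
      using q(2) g(1) unfolding mem_ultra_prod_iff R_def by auto
    ultimately show False
      using ultrafilters_Diff_iff[OF r] ultrafilters_subset[OF r] by simp
  qed
next
  interpret group G by (rule group_G)
  assume ?R
  then obtain F where F: "finite F" "F \<subseteq> carrier G"
    and cover: "\<And>g. g \<in> carrier G \<Longrightarrow> \<exists>f\<in>F. \<phi> f ` A \<in> ultra_act \<phi> g p"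
    using carrier_eq_set_mult_return_set_iff[OF p A] by metis
  have sub: "\<phi> f ` A \<subseteq> E" if "f \<in> F" for f
    using that F(2) image_subset_E[OF _ A] by blast
  show "\<forall>r\<in>orbit_closure p. \<exists>g\<in>carrier G. A \<in> ultra_act \<phi> g r"
  proof
    fix r assume "r \<in> orbit_closure p"
    then have r: "r \<in> ultrafilters E" "\<And>B. B \<in> r \<Longrightarrow> \<exists>g\<in>carrier G. B \<in> ultra_act \<phi> g p"
      unfolding mem_orbit_closure_iff[OF p] by auto
    \<comment> \<open>The cover puts \<open>?U\<close> into every translate of \<open>p\<close>. Its
      complement is then in none of them, so it cannot belong to \<open>r\<close>; finiteness of
      \<open>F\<close> selects a single \<open>fA \<in> r\<close>.\<close>
    let ?U = "\<Union>f\<in>F. \<phi> f ` A"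
    have UE: "?U \<subseteq> E"
      using sub by blast
    have U_iff: "?U \<in> s \<longleftrightarrow> (\<exists>f\<in>F. \<phi> f ` A \<in> s)" if "s \<in> ultrafilters E" for s
      by (rule ultrafilters_UN_iff[OF that F(1)]) (rule sub)
    have "E - ?U \<notin> ultra_act \<phi> g p" if g: "g \<in> carrier G" for g
      using ultrafilters_Diff_iff[OF ultra_act_in_ultrafilters[OF p g] UE]
        U_iff[OF ultra_act_in_ultrafilters[OF p g]] cover[OF g] by simp
    then have "?U \<in> r"
      using r(2) ultrafilters_Diff_iff[OF r(1) UE] by blast
    then obtain f where f: "f \<in> F" "\<phi> f ` A \<in> r"
      using U_iff[OF r(1)] by blast
    then have "f \<in> carrier G"
      using F(2) by blast
    then have "A \<in> ultra_act \<phi> (inv f) r"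
      using f mem_ultra_act_iff[OF r(1) _ A, of "inv f"] by simp
    then show "\<exists>g\<in>carrier G. A \<in> ultra_act \<phi> g r"
      using \<open>f \<in> carrier G\<close> by blast
  qed
qed

end

theorem theorem2p1:
  fixes G :: "('g, 'm) monoid_scheme"
    and X :: "'x set"
    and \<phi> :: "'g \<Rightarrow> 'x \<Rightarrow> 'x"
    and p :: "'x set set"
  assumes "transitive_action G X \<phi>"
    and "p \<in> ultrafilters X"
  shows "minimal_invariant G X \<phi> {ultra_prod G X \<phi> q p | q. q \<in> ultrafilters (carrier G)} \<longleftrightarrow>
    (\<forall>A\<in>p. \<exists>F. finite F \<and> F \<subseteq> carrier G \<and> carrier G = F <#>\<^bsub>G\<^esub> return_set G \<phi> p A)"
proof -
  interpret transitive_action G X \<phi> by fact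
  show ?thesis
    \<comment> \<open>Minimality becomes recurrence of all members of \<open>p\<close>, which is
      exchanged for the finite cover condition one \<open>A\<close> at a time.\<close>
    unfolding orbit_closure_def[symmetric] minimal_invariant_orbit_closure_iff[OF assms(2)]
    by (rule ball_cong[OF refl
      orbit_closure_recurrent_iff_syndetic[OF assms(2) ultrafilters_subset[OF assms(2)]]])
qed

end
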